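(* Let $X_i$ be a real random variable with probability density function (pdf) $f_i$ on $\mathbb{R}$, let $\delta_i\in\mathbb{R}$ be given, and set, for $\lambda\in\mathbb{R}$, $$\psi_i(\lambda)=\log\int_{\mathbb{R}} f_i(x)\exp(\lambda x)\,dx,$$ where the integral can be finite or infinite (with $\psi_i(\lambda)=+\infty$ in the latter case), and $\mathrm{Dom}\,\psi_i=\{\lambda\in\mathbb{R}:\psi_i(\lambda)<+\infty\}$. Consider the mean-shift constraint on a pdf $f_{\mathrm{mod}}$: $$\int x\,f_{\mathrm{mod}}(x)\,dx=\delta_i. \qquad (\mathrm{C})$$ Assume that there exists at least one pdf $f_m$ satisfying (C) and that $\mathrm{Dom}\,\psi_i$ is an open set. Then the optimal perturbed density, i.e. the solution $f_{i\delta_i}$ of the problem of minimizing $KL(f_{\mathrm{mod}},f_i)$ over the pdfs $f_{\mathrm{mod}}$ satisfying (C), is $$f_{i\delta_i}(x)=\exp\big(\lambda^* x-\psi_i(\lambda^* )\big)f_i(x),$$ where $\lambda^*$ is such that (C) holds for $f_{\mathrm{mod}}=f_{i\delta_i}$.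
   Context: For two pdfs $p,q$ on $\mathbb{R}$, the Kullback-Leibler divergence is $KL(p,q)=\int_{-\infty}^{+\infty}p(y)\log\frac{p(y)}{q(y)}\,dy$ if $\log\frac{p(y)}{q(y)}\in L^1(p(y)dy)$. Here $f_i$ is the original density of the input $X_i$, and $f_{i\delta_i}$ is the density of the perturbed input, whose mean is prescribed to be $\delta_i$.
   Formalization: Existence of λ* is asserted only if some pdf f_m satisfying (C) has KL(f_m,f_i) finite; with just any f_m it fails, e.g. f_i uniform on [0,1] and δ_i=5. Optimality and a.e. uniqueness of the tilted density need no such condition. *)

theory Defs
  imports "HOL-Probability.Probability"
begin

definition is_pdf :: "(real \<Rightarrow> real) \<Rightarrow> bool" where
  "is_pdf p \<longleftrightarrow> p \<in> borel_measurable lborel \<and> (\<forall>x. 0 \<le> p x) \<and>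
     (\<integral>\<^sup>+x. ennreal (p x) \<partial>lborel) = 1"

definition mgf_integral :: "(real \<Rightarrow> real) \<Rightarrow> real \<Rightarrow> ennreal" where
  "mgf_integral f l = (\<integral>\<^sup>+x. ennreal (f x * exp (l * x)) \<partial>lborel)"

(* For a pdf f the integral is never 0, so the only infinite value of psi is +infinity. *)
definition psi :: "(real \<Rightarrow> real) \<Rightarrow> real \<Rightarrow> ereal" where
  "psi f l = (if mgf_integral f l = \<infinity> then \<infinity> else ereal (ln (enn2real (mgf_integral f l))))"

definition Dom_psi :: "(real \<Rightarrow> real) \<Rightarrow> real set" where
  "Dom_psi f = {l. psi f l < \<infinity>}"

(* The mean of p exists as an absolutely convergent integral and equals d. *)
definition mean_constraint :: "real \<Rightarrow> (real \<Rightarrow> real) \<Rightarrow> bool" where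
  "mean_constraint d p \<longleftrightarrow> has_bochner_integral lborel (\<lambda>x. x * p x) d"

(* log (p / q) belongs to L1 (p dy). In HOL both r / 0 and ln 0 are 0, so the requirement that
   log (p / q) is finite p-almost everywhere, i.e. that q does not vanish there, is explicit. *)
definition KL_defined :: "(real \<Rightarrow> real) \<Rightarrow> (real \<Rightarrow> real) \<Rightarrow> bool" where
  "KL_defined p q \<longleftrightarrow>
     (AE y in density lborel (\<lambda>y. ennreal (p y)). q y \<noteq> 0) \<and>
     integrable (density lborel (\<lambda>y. ennreal (p y))) (\<lambda>y. ln (p y / q y))"

(* The negative part of p * log (p / q) is always integrable for pdfs p, q, hence +infinity is
   the value of the integral whenever log (p / q) is not in L1 (p dy). *)
definition KL :: "(real \<Rightarrow> real) \<Rightarrow> (real \<Rightarrow> real) \<Rightarrow> ereal" where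
  "KL p q = (if KL_defined p q then ereal (\<integral>y. p y * ln (p y / q y) \<partial>lborel) else \<infinity>)"

lemma KL_eq_KL_divergence:
  assumes "is_pdf p" "is_pdf q" "KL_defined p q"
  shows "KL p q = ereal (KL_divergence (exp 1) (density lborel q) (density lborel p))"
proof -
  have m [measurable]: "p \<in> borel_measurable lborel" "q \<in> borel_measurable lborel"
    and nn: "\<And>x. 0 \<le> p x" "\<And>x. 0 \<le> q x"
    using assms(1,2) by (auto simp: is_pdf_def)
  have "AE y in lborel. 0 < ennreal (p y) \<longrightarrow> q y \<noteq> 0"
    using assms(3) by (simp add: KL_defined_def AE_density)
  then have "AE y in lborel. q y = 0 \<longrightarrow> p y = 0"
    by eventually_elim (use nn in \<open>auto simp: less_le\<close>)
  then have "KL_divergence (exp 1) (density lborel q) (density lborel p)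
      = (\<integral>y. p y * log (exp 1) (p y / q y) \<partial>lborel)"
    by (intro lborel.KL_density_density) (use m nn in auto)
  then show ?thesis
    using assms(3) by (simp add: KL_def log_def)
qed

(* If every pdf with mean d has infinite divergence from f, the problem has no solution;
   this is why a minimizer is required to have finite divergence. *)
definition is_optimal_density :: "(real \<Rightarrow> real) \<Rightarrow> real \<Rightarrow> (real \<Rightarrow> real) \<Rightarrow> bool" where
  "is_optimal_density f d g \<longleftrightarrow>
     is_arg_min (\<lambda>h. KL h f) (\<lambda>h. is_pdf h \<and> mean_constraint d h) g \<and> KL g f < \<infinity>"

(* Only meaningful for l in Dom_psi f, since real_of_ereal \<infinity> = 0. *)
definition tilted :: "(real \<Rightarrow> real) \<Rightarrow> real \<Rightarrow> real \<Rightarrow> real" where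
  "tilted f l x = exp (l * x - real_of_ereal (psi f l)) * f x"

end

theory Submission
  imports Defs
begin

text \<open>
  Write \<open>g\<close> for the tilted density. For every competitor \<open>h\<close> with mean \<open>\<delta>\<close> one has
  \<open>KL h f = KL h g + \<lambda> \<delta> - \<psi> \<lambda>\<close>, so Gibbs' inequality and its equality case give optimality and
  uniqueness of \<open>g\<close>. For the existence of \<open>\<lambda>\<close>, minimise the moment generating function of
  \<open>X - \<delta>\<close>: it is lower semicontinuous by Fatou's lemma, and coercive because a competitor of
  finite divergence forces \<open>f\<close> to charge both sides of \<open>\<delta>\<close>. As the domain is open, the minimiser is
  an interior point, where the derivative vanishes; this is the mean constraint.
\<close>

section \<open>Minimising a moment generating function\<close>

text \<open>Because \<open>exp t\<close> dominates \<open>t\<close>, for \<open>l \<ge> 0\<close>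
  the integral is at least \<open>l\<close> times the integral of the positive part of
  \<open>Y\<close>, which is nonzero. Applied to \<open>Y\<close> and to \<open>- Y\<close>, this
  bounds sublevel sets on both sides.\<close>

lemma nn_integral_exp_bound:
  fixes Y :: "'a \<Rightarrow> real"
  assumes [measurable]: "Y \<in> borel_measurable M"
    and nonneg: "\<not> (AE x in M. Y x \<le> 0)" and "C < \<infinity>"
  shows "\<exists>R. \<forall>l. (\<integral>\<^sup>+x. ennreal (exp (l * Y x)) \<partial>M) \<le> C \<longrightarrow> l \<le> R"
proof -
  \<comment> \<open>\<open>ennreal\<close> sends negative reals to 0, so this is the integral of the
    positive part of \<open>Y\<close>, possibly infinite.\<close>
  define c where "c = (\<integral>\<^sup>+x. ennreal (Y x) \<partial>M)"
  have "c \<noteq> 0"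
    using nonneg by (simp add: c_def nn_integral_0_iff_AE ennreal_eq_0_iff)
  have le: "ennreal l * c \<le> (\<integral>\<^sup>+x. ennreal (exp (l * Y x)) \<partial>M)" if "0 \<le> l" for l
  proof -
    have "ennreal l * c = (\<integral>\<^sup>+x. ennreal (l * Y x) \<partial>M)"
      using that by (simp add: c_def nn_integral_cmult[symmetric] ennreal_mult')
    also have "\<dots> \<le> (\<integral>\<^sup>+x. ennreal (exp (l * Y x)) \<partial>M)"
      by (intro nn_integral_mono ennreal_leI) (use exp_ge_add_one_self in \<open>smt (verit)\<close>)
    finally show ?thesis .
  qed
  have "l \<le> enn2real (C / c)" if l: "(\<integral>\<^sup>+x. ennreal (exp (l * Y x)) \<partial>M) \<le> C" for l
  proof (cases "0 \<le> l")
    case True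
    have lc: "ennreal l * c \<le> C"
      using le[OF True] l by (rule order_trans)
    show ?thesis
    proof (cases "c = \<infinity>")
      \<comment> \<open>Here \<open>C / c = 0\<close>, and a finite \<open>C\<close> leaves only
        \<open>l = 0\<close>.\<close>
      case True
      then show ?thesis
        using lc \<open>C < \<infinity>\<close> \<open>0 \<le> l\<close> by (cases "l = 0") (auto simp: ennreal_mult_top top_unique)
    next
      case False
      then have fin: "C / c < \<infinity>"
        using \<open>c \<noteq> 0\<close> \<open>C < \<infinity>\<close> by (simp add: ennreal_divide_eq_top_iff less_top[symmetric])
      have "ennreal l = ennreal l * c / c"
        using False \<open>c \<noteq> 0\<close> by (simp add: ennreal_mult_divide_eq)
      also have "\<dots> \<le> C / c"
        using lc by (rule divide_right_mono_ennreal)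
      finally show ?thesis
        using fin True by (metis enn2real_ennreal enn2real_mono infinity_ennreal_def)
    qed
  next
    case False
    then show ?thesis by (meson enn2real_nonneg linear order_trans)
  qed
  then show ?thesis by blast
qed

text \<open>Direct method: a minimising sequence stays in a compact interval, and the limit of a
  convergent subsequence is a minimiser by lower semicontinuity. The values may be infinite away
  from 0.\<close>

lemma nn_integral_exp_attains_min:
  fixes Y :: "'a \<Rightarrow> real"
  assumes [measurable]: "Y \<in> borel_measurable M"
    and "finite_measure M"
    and pos: "\<not> (AE x in M. Y x \<le> 0)" and neg: "\<not> (AE x in M. 0 \<le> Y x)"
  shows "\<exists>l. \<forall>k. (\<integral>\<^sup>+x. ennreal (exp (l * Y x)) \<partial>M) \<le> (\<integral>\<^sup>+x. ennreal (exp (k * Y x)) \<partial>M)"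
proof -
  define \<phi> where "\<phi> l = (\<integral>\<^sup>+x. ennreal (exp (l * Y x)) \<partial>M)" for l
  have fin0: "\<phi> 0 < \<infinity>"
    using finite_measure.emeasure_finite[OF assms(2)] by (simp add: \<phi>_def less_top[symmetric])
  obtain R1 where R1: "\<And>l. \<phi> l \<le> \<phi> 0 \<Longrightarrow> l \<le> R1"
    using nn_integral_exp_bound[OF assms(1) pos fin0] unfolding \<phi>_def by auto
  have "\<not> (AE x in M. - Y x \<le> 0)"
    using neg by simp
  then obtain R2 where R2: "\<And>l. \<phi> (- l) \<le> \<phi> 0 \<Longrightarrow> l \<le> R2"
    using nn_integral_exp_bound[of "\<lambda>x. - Y x" M "\<phi> 0"] fin0 unfolding \<phi>_def by auto
  \<comment> \<open>\<open>S\<close> is compact and contains the whole sublevel set of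
    \<open>\<phi> 0\<close>. A point outside \<open>S\<close> cannot beat \<open>0\<close>, which
    lies in \<open>S\<close>, so the infimum over \<open>S\<close> is global.\<close>
  define S where "S = {- R2..R1}"
  have in_S: "l \<in> S" if "\<phi> l \<le> \<phi> 0" for l
    using R1[of l] R2[of "- l"] that by (auto simp: S_def)
  then have "0 \<in> S" by simp
  then have ne: "\<phi> ` S \<noteq> {}" by auto
  obtain u where u: "\<And>n. u n \<in> \<phi> ` S" "u \<longlonglongrightarrow> Inf (\<phi> ` S)"
    using Inf_as_limit[OF ne] by auto
  have "\<forall>n. \<exists>s. s \<in> S \<and> u n = \<phi> s"
    using u(1) by auto
  then obtain s where s: "\<And>n. s n \<in> S" "\<And>n. u n = \<phi> (s n)"
    by metis
  obtain l r where r: "l \<in> S" "strict_mono r" "(s \<circ> r) \<longlonglongrightarrow> l"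
    using s(1) compact_Icc[of "- R2" R1] unfolding S_def compact_def by blast
  \<comment> \<open>The integrand is continuous in the parameter; Fatou then needs no dominating
    function and tolerates infinite values.\<close>
  have "\<phi> l = (\<integral>\<^sup>+x. liminf (\<lambda>n. ennreal (exp (s (r n) * Y x))) \<partial>M)"
    unfolding \<phi>_def
  proof (intro nn_integral_cong lim_imp_Liminf[symmetric])
    fix x
    show "(\<lambda>n. ennreal (exp (s (r n) * Y x))) \<longlonglongrightarrow> ennreal (exp (l * Y x))"
      using r(3) by (auto intro!: tendsto_intros simp: o_def)
  qed simp
  also have "\<dots> \<le> liminf (\<lambda>n. \<phi> (s (r n)))"
    unfolding \<phi>_def by (intro nn_integral_liminf) simp
  also have "\<dots> = Inf (\<phi> ` S)"
    using LIMSEQ_subseq_LIMSEQ[OF u(2) r(2)] s(2) by (intro lim_imp_Liminf) (auto simp: o_def)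
  finally have l: "\<phi> l \<le> Inf (\<phi> ` S)" .
  have "\<phi> l \<le> \<phi> k" for k
  proof (cases "k \<in> S")
    case True
    then show ?thesis using l by (meson INF_lower order_trans)
  next
    case False
    then have "\<phi> 0 \<le> \<phi> k" using in_S[of k] by (meson linear)
    then show ?thesis using l \<open>0 \<in> S\<close> by (meson INF_lower order_trans)
  qed
  then show ?thesis unfolding \<phi>_def by blast
qed

section \<open>Stationarity at an interior minimum\<close>

lemma abs_exp_minus_one_le:
  fixes s :: real
  shows "\<bar>exp s - 1\<bar> \<le> \<bar>s\<bar> * exp \<bar>s\<bar>"
proof (cases "0 \<le> s")
  case True
  have "(1 - s) * exp s \<le> exp (- s) * exp s"
    using exp_ge_add_one_self[of "- s"] by (intro mult_right_mono) auto
  then show ?thesis using True by (simp add: exp_minus algebra_simps)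
next
  case False
  have "1 - exp s \<le> - s" using exp_ge_add_one_self[of s] by linarith
  also have "\<dots> \<le> - s * exp (- s)" using False by (simp add: mult_le_cancel_left1)
  finally show ?thesis using False by simp
qed

text \<open>At a minimum the difference quotients are nonnegative for positive steps and nonpositive
  for negative ones once integrated. The margin \<open>e\<close> on both sides supplies an
  integrable dominating function, so both signs pass to the integral of the derivative.\<close>

lemma exp_minimum_stationary:
  fixes Y :: "'a \<Rightarrow> real"
  assumes [measurable]: "Y \<in> borel_measurable M"
    and "0 < e"
    and fin: "\<And>k. \<bar>k - l\<bar> \<le> e \<Longrightarrow> integrable M (\<lambda>x. exp (k * Y x))"
    and minimum: "\<And>k. \<bar>k - l\<bar> \<le> e \<Longrightarrow> (\<integral>x. exp (l * Y x) \<partial>M) \<le> (\<integral>x. exp (k * Y x) \<partial>M)"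
  shows "has_bochner_integral M (\<lambda>x. Y x * exp (l * Y x)) 0"
proof -
  \<comment> \<open>The margin is split: one half bounds the step size, the other absorbs the factor
    \<open>\<bar>Y x\<bar>\<close> through
    \<open>a * \<bar>Y x\<bar> \<le> exp (a * \<bar>Y x\<bar>)\<close>.\<close>
  define a where "a = e / 2"
  have a: "0 < a" "e = 2 * a" using \<open>0 < e\<close> by (auto simp: a_def)
  define w where "w x = (exp ((l + e) * Y x) + exp ((l - e) * Y x)) / a" for x
  have w: "integrable M w"
    unfolding w_def using fin[of "l + e"] fin[of "l - e"] \<open>0 < e\<close>
    by (intro integrable_divide Bochner_Integration.integrable_add) auto
  have bound: "\<bar>Y x\<bar> * exp (a * \<bar>Y x\<bar>) * exp (l * Y x) \<le> w x" for x
  proof -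
    have "a * \<bar>Y x\<bar> * exp (a * \<bar>Y x\<bar>) \<le> exp (a * \<bar>Y x\<bar>) * exp (a * \<bar>Y x\<bar>)"
      using exp_ge_add_one_self[of "a * \<bar>Y x\<bar>"] by (intro mult_right_mono) (linarith | simp)+
    also have "\<dots> = exp (e * \<bar>Y x\<bar>)" by (simp add: a exp_add[symmetric])
    also have "\<dots> \<le> exp (e * Y x) + exp (- e * Y x)"
      by (cases "0 \<le> Y x") auto
    finally have "a * \<bar>Y x\<bar> * exp (a * \<bar>Y x\<bar>) * exp (l * Y x)
        \<le> (exp (e * Y x) + exp (- e * Y x)) * exp (l * Y x)"
      by (intro mult_right_mono) auto
    also have "\<dots> = exp ((l + e) * Y x) + exp ((l - e) * Y x)"
      by (simp add: algebra_simps exp_add[symmetric])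
    also have "\<dots> = a * w x"
      using a(1) by (simp add: w_def)
    finally show ?thesis using a(1) by (simp add: mult.assoc)
  qed
  \<comment> \<open>Stated for any nonzero null sequence of small steps, so that it serves both
    \<open>t\<close> and its negative.\<close>
  have lim: "integrable M (\<lambda>x. Y x * exp (l * Y x))
      \<and> (\<lambda>n. (\<integral>x. (exp ((l + t n) * Y x) - exp (l * Y x)) / t n \<partial>M))
        \<longlonglongrightarrow> (\<integral>x. Y x * exp (l * Y x) \<partial>M)"
    if t: "t \<longlonglongrightarrow> 0" "\<And>n. t n \<noteq> 0" "\<And>n. \<bar>t n\<bar> \<le> a" for t :: "nat \<Rightarrow> real"
  proof -
    have conv: "(\<lambda>n. (exp ((l + t n) * Y x) - exp (l * Y x)) / t n) \<longlonglongrightarrow> Y x * exp (l * Y x)" for x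
    proof -
      have "((\<lambda>k. exp (k * Y x)) has_real_derivative Y x * exp (l * Y x)) (at l)"
        by (auto intro!: derivative_eq_intros)
      then have "((\<lambda>h. (exp ((l + h) * Y x) - exp (l * Y x)) / h) \<longlongrightarrow> Y x * exp (l * Y x)) (at 0)"
        by (simp add: DERIV_def)
      moreover have "filterlim t (at 0) sequentially"
        using t by (simp add: filterlim_at)
      ultimately show ?thesis by (rule filterlim_compose)
    qed
    have dom: "norm ((exp ((l + t n) * Y x) - exp (l * Y x)) / t n) \<le> w x" for n x
    proof -
      \<comment> \<open>The linear factor \<open>\<bar>t n\<bar>\<close> cancels the denominator,
        which makes the bound uniform in \<open>n\<close>.\<close>
      have "\<bar>exp (t n * Y x) - 1\<bar> \<le> \<bar>t n * Y x\<bar> * exp \<bar>t n * Y x\<bar>"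
        by (rule abs_exp_minus_one_le)
      also have "\<dots> \<le> \<bar>t n * Y x\<bar> * exp (a * \<bar>Y x\<bar>)"
        using t(3)[of n] by (intro mult_left_mono) (auto simp: abs_mult mult_right_mono)
      finally have "\<bar>exp (t n * Y x) - 1\<bar> / \<bar>t n\<bar> \<le> \<bar>Y x\<bar> * exp (a * \<bar>Y x\<bar>)"
        using t(2)[of n] by (simp add: abs_mult field_simps)
      then have "\<bar>exp (t n * Y x) - 1\<bar> / \<bar>t n\<bar> * exp (l * Y x)
          \<le> \<bar>Y x\<bar> * exp (a * \<bar>Y x\<bar>) * exp (l * Y x)"
        by (intro mult_right_mono) auto
      also have "\<bar>exp (t n * Y x) - 1\<bar> / \<bar>t n\<bar> * exp (l * Y x)
          = norm ((exp (t n * Y x) - 1) / t n * exp (l * Y x))"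
        by (simp add: abs_mult)
      also have "(exp (t n * Y x) - 1) / t n * exp (l * Y x)
          = (exp ((l + t n) * Y x) - exp (l * Y x)) / t n"
        by (simp add: algebra_simps exp_add diff_divide_distrib)
      finally show ?thesis using bound[of x] by linarith
    qed
    show ?thesis
      using integrable_dominated_convergence[OF _ _ w, of "\<lambda>x. Y x * exp (l * Y x)"
          "\<lambda>n x. (exp ((l + t n) * Y x) - exp (l * Y x)) / t n"]
        integral_dominated_convergence[OF _ _ w, of "\<lambda>x. Y x * exp (l * Y x)"
          "\<lambda>n x. (exp ((l + t n) * Y x) - exp (l * Y x)) / t n"] conv dom
      by simp
  qed
  have diff: "0 \<le> (\<integral>x. (exp ((l + h) * Y x) - exp (l * Y x)) \<partial>M)" if "\<bar>h\<bar> \<le> a" for h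
    using that a fin[of l] fin[of "l + h"] minimum[of "l + h"] by simp
  define t :: "nat \<Rightarrow> real" where "t n = a / real (Suc n)" for n
  have t: "t \<longlonglongrightarrow> 0" "\<And>n. 0 < t n" "\<And>n. t n \<le> a"
    using a(1) LIMSEQ_Suc[OF lim_const_over_n[of a]]
    by (auto simp: t_def[abs_def] field_simps)
  have t': "(\<lambda>n. - t n) \<longlonglongrightarrow> 0" using tendsto_minus[OF t(1)] by simp
  have abs: "\<And>n. t n \<noteq> 0" "\<And>n. \<bar>t n\<bar> \<le> a" "\<And>n. - t n \<noteq> 0" "\<And>n. \<bar>- t n\<bar> \<le> a"
    using t(2,3) by (auto simp: less_imp_neq[symmetric] abs_of_pos)
  have "0 \<le> (\<integral>x. Y x * exp (l * Y x) \<partial>M)"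
    using lim[OF t(1) abs(1,2)] diff abs(2) t(2)
    by (intro LIMSEQ_le_const[of _ _ 0]) (auto simp: less_imp_le)
  moreover have "(\<integral>x. Y x * exp (l * Y x) \<partial>M) \<le> 0"
    using lim[OF t' abs(3,4)] diff[OF abs(4)] t(2)
    by (intro LIMSEQ_le_const2[of _ _ 0])
      (auto simp: divide_nonneg_pos)
  ultimately show ?thesis
    using lim[OF t(1) abs(1,2)] by (simp add: has_bochner_integral_iff)
qed

section \<open>Gibbs' inequality for the tilted density\<close>

text \<open>For \<open>h \<noteq> 0\<close> the expression is \<open>h * (u - 1 - ln u)\<close> with
  \<open>u = exp a * f / h\<close>, and \<open>ln u \<le> u - 1\<close> with equality only at
  \<open>u = 1\<close>. The terms \<open>- h + exp a * f\<close> give pointwise nonnegativity; they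
  cancel on integration when both are densities.\<close>

lemma gibbs_pointwise:
  fixes h f a :: real
  assumes "0 \<le> h" "0 \<le> f" "h \<noteq> 0 \<longrightarrow> f \<noteq> 0"
  shows "0 \<le> h * ln (h / f) - h * a - h + exp a * f"
    and "h * ln (h / f) - h * a - h + exp a * f = 0 \<Longrightarrow> h = exp a * f"
proof -
  define u where "u = exp a * f / h"
  have eq: "h * ln (h / f) - h * a - h + exp a * f = h * (u - 1 - ln u)" "0 < u" if "h \<noteq> 0"
    using that assms by (auto simp: u_def ln_div ln_mult less_le algebra_simps)
  show "0 \<le> h * ln (h / f) - h * a - h + exp a * f"
  proof (cases "h = 0")
    case False
    then show ?thesis
      unfolding eq(1)[OF False] using ln_le_minus_one[OF eq(2)] assms(1) by simp
  qed (use assms in auto)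
  show "h = exp a * f" if 0: "h * ln (h / f) - h * a - h + exp a * f = 0"
  proof (cases "h = 0")
    case False
    then have "ln u = u - 1" using 0 eq(1) by simp
    then have "u = 1" using ln_eq_minus_one[OF eq(2)[OF False]] by simp
    then show ?thesis using False by (simp add: u_def)
  qed (use 0 in auto)
qed

section \<open>Normalisation of the tilted density\<close>

lemma is_pdf_has_integral:
  assumes "is_pdf p"
  shows "has_bochner_integral lborel p 1"
  using assms by (intro has_bochner_integral_nn_integral) (auto simp: is_pdf_def)

lemma Dom_psi_iff: "l \<in> Dom_psi f \<longleftrightarrow> mgf_integral f l < \<infinity>"
  by (auto simp: Dom_psi_def psi_def less_top[symmetric])

lemma mgf_integral_pos:
  assumes "is_pdf f"
  shows "0 < mgf_integral f l"
proof (rule ccontr)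
  have [measurable]: "f \<in> borel_measurable borel" and nn: "\<And>x. 0 \<le> f x"
    using assms by (auto simp: is_pdf_def)
  assume "\<not> 0 < mgf_integral f l"
  then have "AE x in lborel. ennreal (f x * exp (l * x)) = 0"
    by (simp add: mgf_integral_def nn_integral_0_iff_AE)
  then have "AE x in lborel. ennreal (f x) = 0"
    by eventually_elim (use nn in \<open>simp add: ennreal_eq_0_iff mult_le_0_iff\<close>)
  then have "(\<integral>\<^sup>+x. ennreal (f x) \<partial>lborel) = 0"
    by (simp add: nn_integral_0_iff_AE)
  then show False using assms by (simp add: is_pdf_def)
qed

text \<open>The integral is positive and finite, so the exponential undoes the \<open>ln\<close> in
  \<open>psi\<close> and leaves division by the normalising constant.\<close>

lemma tilted_eq:
  assumes "is_pdf f" "l \<in> Dom_psi f"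
  shows "tilted f l x = f x * exp (l * x) / enn2real (mgf_integral f l)"
  using assms mgf_integral_pos[OF assms(1), of l]
  by (simp add: tilted_def psi_def Dom_psi_iff exp_diff enn2real_positive_iff)

lemma is_pdf_tilted:
  assumes "is_pdf f" "l \<in> Dom_psi f"
  shows "is_pdf (tilted f l)"
proof -
  have [measurable]: "f \<in> borel_measurable borel" and nn: "\<And>x. 0 \<le> f x"
    using assms by (auto simp: is_pdf_def)
  define Z where "Z = enn2real (mgf_integral f l)"
  have Z: "0 < Z" "mgf_integral f l = ennreal Z"
    using assms mgf_integral_pos[OF assms(1), of l] by (auto simp: Z_def Dom_psi_iff enn2real_positive_iff)
  have "(\<integral>\<^sup>+x. ennreal (tilted f l x) \<partial>lborel) = (\<integral>\<^sup>+x. ennreal (f x * exp (l * x)) / ennreal Z \<partial>lborel)"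
    using Z nn by (intro nn_integral_cong) (simp add: tilted_eq[OF assms] Z_def[symmetric] divide_ennreal)
  also have "\<dots> = 1"
    using Z by (simp add: nn_integral_divide mgf_integral_def[symmetric] divide_ennreal)
  finally show ?thesis
    using nn by (auto simp: is_pdf_def tilted_def[abs_def])
qed

lemma KL_definedD:
  assumes "is_pdf p" "is_pdf q" "KL_defined p q"
  shows "AE x in lborel. p x \<noteq> 0 \<longrightarrow> q x \<noteq> 0"
    and "integrable lborel (\<lambda>x. p x * ln (p x / q x))"
proof -
  have [measurable]: "p \<in> borel_measurable borel" "q \<in> borel_measurable borel"
    and nn: "\<And>x. 0 \<le> p x"
    using assms by (auto simp: is_pdf_def)
  show "AE x in lborel. p x \<noteq> 0 \<longrightarrow> q x \<noteq> 0"
    using assms(3) nn by (auto simp: KL_defined_def AE_density less_le)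
  show "integrable lborel (\<lambda>x. p x * ln (p x / q x))"
    using assms(3) nn by (auto simp: KL_defined_def integrable_density)
qed

text \<open>Where \<open>f\<close> is nonzero, the log-ratio of the tilted density to
  \<open>f\<close> is affine in \<open>x\<close>, so the divergence depends only on total mass and
  mean.\<close>

lemma KL_tilted:
  assumes f: "is_pdf f" and l: "l \<in> Dom_psi f" and mean: "mean_constraint d (tilted f l)"
  shows "KL (tilted f l) f = ereal (l * d - real_of_ereal (psi f l))"
proof -
  define c where "c = real_of_ereal (psi f l)"
  define g where "g = tilted f l"
  have g: "is_pdf g" "\<And>x. g x = exp (l * x - c) * f x"
    using is_pdf_tilted[OF f l] by (auto simp: g_def tilted_def c_def)
  have [measurable]: "f \<in> borel_measurable borel" "g \<in> borel_measurable borel"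
    and nn: "\<And>x. 0 \<le> g x"
    using f g(1) by (auto simp: is_pdf_def)
  \<comment> \<open>Where \<open>f x = 0\<close>, also \<open>g x = 0\<close>, and both sides
    vanish.\<close>
  have log: "g x * ln (g x / f x) = l * (x * g x) - c * g x" for x
    by (cases "f x = 0") (simp_all add: g(2) algebra_simps)
  have hb: "has_bochner_integral lborel (\<lambda>x. l * (x * g x) - c * g x) (l * d - c * 1)"
    using mean is_pdf_has_integral[OF g(1)] unfolding mean_constraint_def g_def[symmetric]
    by (intro has_bochner_integral_diff has_bochner_integral_mult_right) auto
  have "KL_defined g f"
    unfolding KL_defined_def
  proof
    show "AE y in density lborel (\<lambda>y. ennreal (g y)). f y \<noteq> 0"
      by (auto simp: AE_density g(2))
    show "integrable (density lborel (\<lambda>y. ennreal (g y))) (\<lambda>y. ln (g y / f y))"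
      using hb nn by (simp add: integrable_density log has_bochner_integral_iff)
  qed
  then show ?thesis
    using hb by (simp add: KL_def log g_def[symmetric] c_def[symmetric] has_bochner_integral_iff)
qed

text \<open>All competitors have the same mean, so the affine log-ratio of the tilted density to
  \<open>f\<close> has the same integral against each of them. What remains of the divergence is the
  nonnegative integral of the Gibbs expression.\<close>

lemma KL_gibbs:
  assumes f: "is_pdf f" and l: "l \<in> Dom_psi f"
    and h: "is_pdf h" and mean: "mean_constraint d h"
  shows "ereal (l * d - real_of_ereal (psi f l)) \<le> KL h f"
    and "KL h f = ereal (l * d - real_of_ereal (psi f l)) \<Longrightarrow> AE x in lborel. h x = tilted f l x"
proof -
  define c where "c = real_of_ereal (psi f l)"
  \<comment> \<open>This is the expression of \<open>gibbs_pointwise\<close> with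
    \<open>a = l * x - c\<close>. Its last two terms integrate to \<open>- 1 + 1\<close>.\<close>
  define D where "D x = h x * ln (h x / f x) - h x * (l * x - c) - h x + exp (l * x - c) * f x" for x
  define K where "K = (\<integral>x. h x * ln (h x / f x) \<partial>lborel)"
  have tilted: "tilted f l = (\<lambda>x. exp (l * x - c) * f x)"
    by (auto simp: tilted_def c_def)
  have nn: "\<And>x. 0 \<le> h x" "\<And>x. 0 \<le> f x"
    using f h by (auto simp: is_pdf_def)
  have D: "has_bochner_integral lborel D (K - (l * d - c))" "AE x in lborel. 0 \<le> D x"
    "AE x in lborel. D x = 0 \<longrightarrow> h x = tilted f l x" if def: "KL_defined h f"
  proof -
    have "has_bochner_integral lborel (\<lambda>x. h x * ln (h x / f x) - (l * (x * h x) - c * h x) - h x + exp (l * x - c) * f x)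
        (K - (l * d - c * 1) - 1 + 1)"
      using KL_definedD(2)[OF h f def] mean is_pdf_has_integral[OF h]
        is_pdf_has_integral[OF is_pdf_tilted[OF f l]]
      unfolding mean_constraint_def tilted K_def
      by (intro has_bochner_integral_add has_bochner_integral_diff has_bochner_integral_mult_right
          has_bochner_integral_integrable) auto
    then show "has_bochner_integral lborel D (K - (l * d - c))"
      by (simp add: D_def[abs_def] algebra_simps)
    show "AE x in lborel. 0 \<le> D x"
      using KL_definedD(1)[OF h f def] unfolding D_def
      by eventually_elim (use nn gibbs_pointwise(1) in blast)
    show "AE x in lborel. D x = 0 \<longrightarrow> h x = tilted f l x"
      using KL_definedD(1)[OF h f def] unfolding D_def tilted
      by eventually_elim (use nn gibbs_pointwise(2) in blast)
  qed
  have KL: "KL h f = ereal K" if "KL_defined h f"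
    using that by (simp add: KL_def K_def)
  show "ereal (l * d - real_of_ereal (psi f l)) \<le> KL h f"
  proof (cases "KL_defined h f")
    case True
    have "0 \<le> K - (l * d - c)"
      using D(1)[OF True] integral_nonneg_AE[OF D(2)[OF True]] by (simp add: has_bochner_integral_iff)
    then show ?thesis using KL[OF True] by (simp add: c_def)
  qed (simp add: KL_def)
  show "AE x in lborel. h x = tilted f l x"
    if eq: "KL h f = ereal (l * d - real_of_ereal (psi f l))"
  proof -
    \<comment> \<open>A finite value excludes the default \<open>\<infinity>\<close> of
      \<open>KL\<close>; equality then makes the nonnegative \<open>D\<close> integrate to
      0.\<close>
    have def: "KL_defined h f" using eq by (auto simp: KL_def split: if_splits)
    then have "integrable lborel D" "integral\<^sup>L lborel D = 0"
      using D(1) eq KL by (auto simp: has_bochner_integral_iff c_def)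
    then have "AE x in lborel. D x = 0"
      using D(2)[OF def] integral_nonneg_eq_0_iff_AE by blast
    then show ?thesis using D(3)[OF def] by eventually_elim auto
  qed
qed

section \<open>Solving the mean constraint\<close>

text \<open>If \<open>f\<close> lived on one side of \<open>d\<close>, so would \<open>h\<close>,
  and \<open>x - d\<close> would keep one sign while averaging to 0 under \<open>h\<close>. Then
  \<open>h\<close> would vanish off the null set \<open>{d}\<close>. The sign of \<open>s\<close>
  selects the side.\<close>

lemma mean_not_one_sided:
  assumes h: "is_pdf h" and mean: "mean_constraint d h" and "s \<noteq> 0"
    and "AE x in lborel. h x \<noteq> 0 \<longrightarrow> f x \<noteq> 0"
  shows "\<not> (AE x in lborel. f x \<noteq> 0 \<longrightarrow> s * (x - d) \<le> (0::real))"
proof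
  assume "AE x in lborel. f x \<noteq> 0 \<longrightarrow> s * (x - d) \<le> 0"
  with assms(4) have ae: "AE x in lborel. h x \<noteq> 0 \<longrightarrow> s * (x - d) \<le> 0"
    by eventually_elim auto
  have nn: "\<And>x. 0 \<le> h x" using h by (simp add: is_pdf_def)
  have "has_bochner_integral lborel (\<lambda>x. (- s) * (x * h x - d * h x)) ((- s) * (d - d * 1))"
    using mean is_pdf_has_integral[OF h] unfolding mean_constraint_def
    by (intro has_bochner_integral_mult_right has_bochner_integral_diff) auto
  moreover have "AE x in lborel. 0 \<le> (- s) * (x * h x - d * h x)"
    using ae
  proof eventually_elim
    case (elim x)
    have "0 \<le> - (s * (x - d)) * h x"
      using elim nn[of x] by (cases "h x = 0") (auto simp: mult_nonpos_nonneg)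
    then show ?case by (simp add: algebra_simps)
  qed
  ultimately have "AE x in lborel. (- s) * (x * h x - d * h x) = 0"
    using integral_nonneg_eq_0_iff_AE[of lborel "\<lambda>x. (- s) * (x * h x - d * h x)"]
    by (simp add: has_bochner_integral_iff)
  moreover have "AE x in lborel. x \<noteq> d" by (rule AE_lborel_singleton)
  ultimately have "AE x in lborel. h x = 0"
    by eventually_elim (use \<open>s \<noteq> 0\<close> in \<open>auto simp: left_diff_distrib[symmetric]\<close>)
  then have "(\<integral>x. h x \<partial>lborel) = 0"
    by (rule integral_eq_zero_AE)
  then show False
    using is_pdf_has_integral[OF h] by (simp add: has_bochner_integral_iff)
qed

text \<open>Centring at \<open>d\<close> turns the mean constraint into the stationarity equation of
  \<open>\<phi>\<close>; \<open>h\<close> serves to show that \<open>f\<close> charges both sides of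
  \<open>d\<close>.\<close>

lemma exists_tilted_mean:
  assumes f: "is_pdf f" and op: "open (Dom_psi f)"
    and h: "is_pdf h" "mean_constraint d h"
    and ac: "AE x in lborel. h x \<noteq> 0 \<longrightarrow> f x \<noteq> 0"
  shows "\<exists>l\<in>Dom_psi f. mean_constraint d (tilted f l)"
proof -
  have [measurable]: "f \<in> borel_measurable borel" and nn: "\<And>x. 0 \<le> f x"
    using f by (auto simp: is_pdf_def)
  define N where "N = density lborel (\<lambda>x. ennreal (f x))"
  define \<phi> where "\<phi> l = (\<integral>\<^sup>+x. ennreal (exp (l * (x - d))) \<partial>N)" for l
  have [measurable]: "(\<lambda>x. x - d) \<in> borel_measurable N" by (simp add: N_def)
  have fin: "finite_measure N"
    using f by (intro finite_measureI) (simp add: N_def emeasure_density is_pdf_def)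
  have \<phi>: "\<phi> l = ennreal (exp (- l * d)) * mgf_integral f l" for l
  proof -
    have "\<phi> l = (\<integral>\<^sup>+x. ennreal (exp (- l * d)) * ennreal (f x * exp (l * x)) \<partial>lborel)"
      unfolding \<phi>_def N_def
      by (subst nn_integral_density)
        (auto intro!: nn_integral_cong simp: ennreal_mult[symmetric] nn exp_add[symmetric] algebra_simps)
    then show ?thesis by (simp add: nn_integral_cmult mgf_integral_def)
  qed
  \<comment> \<open>Centring only multiplies the integral by a positive finite factor, so finiteness
    is unaffected.\<close>
  have Dom: "k \<in> Dom_psi f \<longleftrightarrow> \<phi> k < \<infinity>" for k
    by (auto simp: \<phi> Dom_psi_iff ennreal_mult_less_top ennreal_mult_eq_top_iff less_top[symmetric])
  have side: "\<not> (AE x in N. s * (x - d) \<le> 0)" if "s \<noteq> 0" for s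
  proof -
    have "(AE x in N. s * (x - d) \<le> 0) \<longleftrightarrow> (AE x in lborel. f x \<noteq> 0 \<longrightarrow> s * (x - d) \<le> 0)"
      unfolding N_def using nn by (subst AE_density) (auto simp: less_le)
    then show ?thesis using mean_not_one_sided[OF h that ac] by simp
  qed
  obtain l where l: "\<And>k. \<phi> l \<le> \<phi> k"
    using nn_integral_exp_attains_min[of "\<lambda>x. x - d" N] fin side[of 1] side[of "- 1"]
    unfolding \<phi>_def by auto
  \<comment> \<open>The value at 0 is the total mass of \<open>f\<close>, so the minimum is finite
    and the minimiser lies in the domain. Openness then gives a closed ball, whose endpoints
    \<open>l + e\<close> and \<open>l - e\<close> enter the domination.\<close>
  have "\<phi> 0 < \<infinity>"
    using f by (simp add: \<phi> mgf_integral_def is_pdf_def)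
  then have lD: "l \<in> Dom_psi f"
    using l[of 0] by (auto simp: Dom intro: le_less_trans)
  then obtain e where e: "0 < e" "cball l e \<subseteq> Dom_psi f"
    using op open_contains_cball by blast
  have \<phi>_fin: "\<phi> k < \<infinity>" if "\<bar>k - l\<bar> \<le> e" for k
  proof -
    have "k \<in> cball l e" using that by (simp add: dist_real_def abs_minus_commute)
    then show ?thesis using e(2) Dom by blast
  qed
  have int: "has_bochner_integral N (\<lambda>x. exp (k * (x - d))) (enn2real (\<phi> k))" if "\<bar>k - l\<bar> \<le> e" for k
  proof (rule has_bochner_integral_nn_integral)
    show "(\<integral>\<^sup>+x. ennreal (exp (k * (x - d))) \<partial>N) = ennreal (enn2real (\<phi> k))"
      using \<phi>_fin[OF that] by (simp add: \<phi>_def)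
  qed auto
  have "has_bochner_integral N (\<lambda>x. (x - d) * exp (l * (x - d))) 0"
  proof (rule exp_minimum_stationary[OF _ e(1)])
    fix k assume k: "\<bar>k - l\<bar> \<le> e"
    show "integrable N (\<lambda>x. exp (k * (x - d)))"
      using int[OF k] by (simp add: has_bochner_integral_iff)
    show "(\<integral>x. exp (l * (x - d)) \<partial>N) \<le> (\<integral>x. exp (k * (x - d)) \<partial>N)"
      using int[OF k] int[of l] e(1) l[of k] \<phi>_fin[OF k] by (simp add: has_bochner_integral_iff enn2real_mono)
  qed simp
  then have s: "has_bochner_integral lborel (\<lambda>x. f x * ((x - d) * exp (l * (x - d)))) 0"
    using nn by (simp add: N_def has_bochner_integral_iff integrable_density integral_density)
  \<comment> \<open>\<open>C\<close> undoes the centring and normalises: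
    \<open>C * exp (l * (x - d)) * f x\<close> is the tilted density. Writing \<open>x\<close> as
    \<open>(x - d) + d\<close> then yields the mean \<open>0 + d\<close>.\<close>
  define C where "C = exp (l * d) / enn2real (mgf_integral f l)"
  have "C * (f x * ((x - d) * exp (l * (x - d)))) + d * tilted f l x = x * tilted f l x" for x
  proof -
    have "exp (l * d) * exp (l * (x - d)) = exp (l * x)"
      by (simp add: exp_add[symmetric] algebra_simps)
    then have "C * exp (l * (x - d)) = exp (l * x) / enn2real (mgf_integral f l)"
      by (simp add: C_def)
    then have "C * (f x * ((x - d) * exp (l * (x - d)))) = (x - d) * tilted f l x"
      by (simp add: tilted_eq[OF f lD])
        (metis (no_types, lifting) mult.assoc mult.commute times_divide_eq_right)
    then show ?thesis by (simp add: algebra_simps)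
  qed
  moreover have "has_bochner_integral lborel
      (\<lambda>x. C * (f x * ((x - d) * exp (l * (x - d)))) + d * tilted f l x) (C * 0 + d * 1)"
    using s is_pdf_has_integral[OF is_pdf_tilted[OF f lD]]
    by (intro has_bochner_integral_add has_bochner_integral_mult_right) auto
  ultimately have "mean_constraint d (tilted f l)"
    by (simp add: mean_constraint_def)
  with lD show ?thesis by blast
qed

text \<open>Uniqueness is almost everywhere, since changes on a null set affect neither mean nor
  divergence. Existence of the parameter is conditional on an admissible density of finite
  divergence, without which there is no optimal density.\<close>

theorem proposition2p2:
  fixes M :: "'a measure" and X :: "'a \<Rightarrow> real" and f :: "real \<Rightarrow> real" and \<delta> :: real
  assumes "prob_space M"
    and "is_pdf f"
    and "distributed M lborel X (\<lambda>x. ennreal (f x))"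
    and "\<exists>f\<^sub>m. is_pdf f\<^sub>m \<and> mean_constraint \<delta> f\<^sub>m"
    and "open (Dom_psi f)"
  shows "(\<forall>l\<in>Dom_psi f. mean_constraint \<delta> (tilted f l) \<longrightarrow>
            is_optimal_density f \<delta> (tilted f l) \<and>
            (\<forall>g. is_optimal_density f \<delta> g \<longrightarrow> (AE x in lborel. g x = tilted f l x)))
       \<and> ((\<exists>f\<^sub>m. is_pdf f\<^sub>m \<and> mean_constraint \<delta> f\<^sub>m \<and> KL f\<^sub>m f < \<infinity>) \<longrightarrow>
            (\<exists>l\<in>Dom_psi f. mean_constraint \<delta> (tilted f l)))"
proof (intro conjI ballI impI allI)
  fix l assume l: "l \<in> Dom_psi f" and mean: "mean_constraint \<delta> (tilted f l)"
  note f = \<open>is_pdf f\<close>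
  note KL_l = KL_tilted[OF f l mean]
  show "is_optimal_density f \<delta> (tilted f l)"
    using KL_gibbs(1)[OF f l] is_pdf_tilted[OF f l] mean
    by (auto simp: is_optimal_density_def is_arg_min_def KL_l not_less)
  \<comment> \<open>Optimality of \<open>g\<close> bounds its divergence above by that of the tilted
    density, and Gibbs bounds it below, so the equality case applies.\<close>
  fix g assume "is_optimal_density f \<delta> g"
  then have g: "is_pdf g" "mean_constraint \<delta> g" and "\<not> KL (tilted f l) f < KL g f"
    using is_pdf_tilted[OF f l] mean by (auto simp: is_optimal_density_def is_arg_min_def)
  then have "KL g f = ereal (l * \<delta> - real_of_ereal (psi f l))"
    using KL_gibbs(1)[OF f l g] by (simp add: KL_l)
  then show "AE x in lborel. g x = tilted f l x"
    by (rule KL_gibbs(2)[OF f l g])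
next
  \<comment> \<open>Finite divergence yields \<open>KL_defined\<close>, hence that \<open>h\<close>
    vanishes almost everywhere where \<open>f\<close> does.\<close>
  assume "\<exists>f\<^sub>m. is_pdf f\<^sub>m \<and> mean_constraint \<delta> f\<^sub>m \<and> KL f\<^sub>m f < \<infinity>"
  then obtain h where h: "is_pdf h" "mean_constraint \<delta> h" and "KL_defined h f"
    by (auto simp: KL_def split: if_splits)
  then show "\<exists>l\<in>Dom_psi f. mean_constraint \<delta> (tilted f l)"
    using exists_tilted_mean[OF assms(2,5) h] KL_definedD(1)[OF h(1) assms(2)] by blast
qed

end
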